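(* Let $U:\mathbb{R}^3\to\mathbb{R}$ be a scalar potential with $E(x)=-\nabla_x U(x)$, let $B:\mathbb{R}^3\to\mathbb{R}^3$ be a magnetic field, let $x^0,v^0\in\mathbb{R}^3$, $T>0$, and let $h>0$ be a time stepsize such that $T/h$ is a positive integer. Put $r^0=\exp(U(x^0))$ and let $(x^n,v^n,r^n)_{0\le n\le T/h}$ be the numerical solution generated from $(x^0,v^0,r^0)$ either by the scheme S1-ESAV or by the scheme S2-ESAV. Then each of the two schemes exactly preserves the energy $H(x^0,v^0)=\frac12|v^0|^2+U(x^0)$, in the sense that $$\hat H(v^n,r^n)=\hat H(v^0,r^0)=H(x^0,v^0)\qquad\text{for all } n=1,2,\dots,T/h,$$ where $\hat H(v,r)=\frac12|v|^2+\ln(r)$.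
   Context: The charged-particle dynamics is the system $\ddot x(t)=\dot x(t)\times B(x(t))+E(x(t))$, $x(0)=x^0$, $\dot x(0)=v^0$, $t\in[0,T]$, with $x(t)\in\mathbb{R}^3$, $v(t)=\dot x(t)$, magnetic field $B(x)=(b_1(x),b_2(x),b_3(x))^\intercal$ and electric field $E(x)=-\nabla_x U(x)$. Its total energy is $H(x,v)=\frac12|v|^2+U(x)$, where $|\cdot|$ is the Euclidean norm. Define the skew-symmetric matrix $$\tilde B(x)=\begin{pmatrix} 0 & b_3(x) & -b_2(x) \\ -b_3(x) & 0 & b_1(x) \\ b_2(x) & -b_1(x) & 0 \end{pmatrix},$$ so that $\tilde B(x)v=v\times B(x)$; $e^{\tau\tilde B(x)}$ denotes the matrix exponential. For $x\in\mathbb{R}^3$, $r\in\mathbb{R}$ define $F(x,r)=\frac{E(x)}{\exp(U(x))}\,r$. The scalar auxiliary variable is $r(t)=\exp(U(x(t)))$. Scheme S1-ESAV: given $(x^n,v^n,r^n)$ with $r^n>0$, set $w^n=e^{h\tilde B(x^n)}v^n$, $\hat x^{n+1/2}=x^n+\frac h2 w^n$, $\hat r^{n+1/2}=r^n-\frac h2\exp(U(\hat x^{n+1/2}))\,(w^n)^\intercal E(\hat x^{n+1/2})$, $F^n=F(\hat x^{n+1/2},\hat r^{n+1/2})$, and $$x^{n+1}=x^n+h w^n+\tfrac{h^2}{2}F^n,\quad v^{n+1}=w^n+hF^n,\quad \ln(r^{n+1})=\ln(r^n)-(x^{n+1}-x^n)^\intercal F^n .$$ Scheme S2-ESAV: given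 $(x^n,v^n,r^n)$ with $r^n>0$, set $w^n=e^{\frac h2\tilde B(x^n)}v^n$, $\hat x^{n+1/2}=x^n+\frac h2 w^n$, $\hat r^{n+1/2}=r^n-\frac h2\exp(U(\hat x^{n+1/2}))\,(w^n)^\intercal E(\hat x^{n+1/2})$, $F^n=F(\hat x^{n+1/2},\hat r^{n+1/2})$, and $$x^{n+1}=x^n+h w^n+\tfrac{h^2}{2}F^n,\quad v^{n+1}=e^{\frac h2\tilde B(x^{n+1})}\left[w^n+hF^n\right],\quad \ln(r^{n+1})=\ln(r^n)-(x^{n+1}-x^n)^\intercal F^n .$$ In both schemes $r^{n+1}$ is the positive number $\exp\left[\ln(r^n)-(x^{n+1}-x^n)^\intercal F^n\right]$. *)

theory Defs
  imports "HOL-Analysis.Analysis"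
begin

text \<open>The ring multiplication on \<open>real ^ 3 ^ 3\<close> is componentwise, so neither the overloaded
  power nor the overloaded \<^const>\<open>exp\<close> is the matrix one; the matrix exponential is the
  power series formed with the matrix product \<open>**\<close>.\<close>

definition matrix_power :: "real ^ 'n ^ 'n \<Rightarrow> nat \<Rightarrow> real ^ 'n ^ 'n" where
  "matrix_power A k = (((**) A) ^^ k) (mat 1)"

definition matrix_exp :: "real ^ 'n ^ 'n \<Rightarrow> real ^ 'n ^ 'n" where
  "matrix_exp A = (\<Sum>k. (1 / fact k) *\<^sub>R matrix_power A k)"

definition B_tilde :: "(real ^ 3 \<Rightarrow> real ^ 3) \<Rightarrow> real ^ 3 \<Rightarrow> real ^ 3 ^ 3" where
  "B_tilde B x = vector
     [vector [0, B x $ 3, - (B x $ 2)],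
      vector [- (B x $ 3), 0, B x $ 1],
      vector [B x $ 2, - (B x $ 1), 0]]"

lemma B_tilde_mult_eq_cross3: "B_tilde B x *v v = cross3 v (B x)"
  by (simp add: B_tilde_def cross3_def vec_eq_iff forall_3 matrix_vector_mult_def sum_3)

definition energy :: "(real ^ 3 \<Rightarrow> real) \<Rightarrow> real ^ 3 \<Rightarrow> real ^ 3 \<Rightarrow> real" where
  "energy U x v = 1 / 2 * (norm v)\<^sup>2 + U x"

definition modified_energy :: "real ^ 3 \<Rightarrow> real \<Rightarrow> real" where
  "modified_energy v r = 1 / 2 * (norm v)\<^sup>2 + ln r"

definition ESAV_F ::
  "(real ^ 3 \<Rightarrow> real) \<Rightarrow> (real ^ 3 \<Rightarrow> real ^ 3) \<Rightarrow> real ^ 3 \<Rightarrow> real \<Rightarrow> real ^ 3" where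
  "ESAV_F U E x r = r *\<^sub>R (E x /\<^sub>R exp (U x))"

type_synonym esav_state = "(real ^ 3) \<times> (real ^ 3) \<times> real"

text \<open>One step of each scheme, mapping \<open>(x\<^sup>n, v\<^sup>n, r\<^sup>n)\<close> to the next state. The update
  of \<open>r\<close> is given through \<open>ln r\<close>; the new \<open>r\<close> is the positive number with the
  prescribed logarithm.\<close>

definition S1_ESAV_step ::
  "(real ^ 3 \<Rightarrow> real) \<Rightarrow> (real ^ 3 \<Rightarrow> real ^ 3) \<Rightarrow> (real ^ 3 \<Rightarrow> real ^ 3) \<Rightarrow> real \<Rightarrow>
    esav_state \<Rightarrow> esav_state" where
  "S1_ESAV_step U E B h = (\<lambda>(x, v, r).
     let w = matrix_exp (h *\<^sub>R B_tilde B x) *v v;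
         xh = x + (h / 2) *\<^sub>R w;
         rh = r - h / 2 * exp (U xh) * (w \<bullet> E xh);
         F = ESAV_F U E xh rh;
         x' = x + h *\<^sub>R w + (h\<^sup>2 / 2) *\<^sub>R F;
         v' = w + h *\<^sub>R F;
         r' = exp (ln r - (x' - x) \<bullet> F)
     in (x', v', r'))"

definition S2_ESAV_step ::
  "(real ^ 3 \<Rightarrow> real) \<Rightarrow> (real ^ 3 \<Rightarrow> real ^ 3) \<Rightarrow> (real ^ 3 \<Rightarrow> real ^ 3) \<Rightarrow> real \<Rightarrow>
    esav_state \<Rightarrow> esav_state" where
  "S2_ESAV_step U E B h = (\<lambda>(x, v, r).
     let w = matrix_exp ((h / 2) *\<^sub>R B_tilde B x) *v v;
         xh = x + (h / 2) *\<^sub>R w;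
         rh = r - h / 2 * exp (U xh) * (w \<bullet> E xh);
         F = ESAV_F U E xh rh;
         x' = x + h *\<^sub>R w + (h\<^sup>2 / 2) *\<^sub>R F;
         v' = matrix_exp ((h / 2) *\<^sub>R B_tilde B x') *v (w + h *\<^sub>R F);
         r' = exp (ln r - (x' - x) \<bullet> F)
     in (x', v', r'))"

definition numerical_solution ::
  "(esav_state \<Rightarrow> esav_state) \<Rightarrow> (nat \<Rightarrow> real ^ 3) \<Rightarrow> (nat \<Rightarrow> real ^ 3) \<Rightarrow> (nat \<Rightarrow> real) \<Rightarrow>
    nat \<Rightarrow> bool" where
  "numerical_solution step x v r N \<longleftrightarrow>
     (\<forall>n<N. (x (Suc n), v (Suc n), r (Suc n)) = step (x n, v n, r n))"

end

theory Submission
  imports Defs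
begin

text \<open>The magnetic substeps are rotations, since the exponential of a skew-symmetric matrix is
  orthogonal. The electric substep changes the kinetic energy by
  \<open>h w \<bullet> F + (h\<^sup>2/2) |F|\<^sup>2 = (x' - x) \<bullet> F\<close>, which is exactly what
  the update subtracts from \<open>ln r\<close>.\<close>

text \<open>Reduction to the scalar Cauchy product in each coordinate:
  \<open>\<bar>u k \<bullet> b\<bar> \<le> norm (u k)\<close> passes absolute convergence on, and
  the finite sum over \<open>Basis\<close> reassembles the inner products.\<close>

lemma Cauchy_product_inner_sums:
  fixes f g :: "nat \<Rightarrow> 'a::euclidean_space"
  assumes f: "summable (\<lambda>k. norm (f k))" and g: "summable (\<lambda>k. norm (g k))"
  shows "(\<lambda>n. \<Sum>i\<le>n. f i \<bullet> g (n - i)) sums (suminf f \<bullet> suminf g)"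
proof -
  have comp: "summable (\<lambda>k. norm (u k \<bullet> b))" "suminf u \<bullet> b = (\<Sum>k. u k \<bullet> b)"
    if "summable (\<lambda>k. norm (u k))" "b \<in> Basis" for u :: "nat \<Rightarrow> 'a" and b
  proof -
    show "summable (\<lambda>k. norm (u k \<bullet> b))"
      using that by (intro summable_comparison_test'[OF that(1)]) (simp add: Basis_le_norm)
    show "suminf u \<bullet> b = (\<Sum>k. u k \<bullet> b)"
      by (rule bounded_linear.suminf[OF bounded_linear_inner_left summable_norm_cancel[OF that(1)]])
  qed
  have "(\<lambda>n. \<Sum>b\<in>Basis. \<Sum>i\<le>n. (f i \<bullet> b) * (g (n - i) \<bullet> b))
      sums (\<Sum>b\<in>Basis. (suminf f \<bullet> b) * (suminf g \<bullet> b))"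
    by (intro sums_sum, subst comp(2)[OF f], assumption, subst comp(2)[OF g], assumption)
      (intro Cauchy_product_sums comp(1) f g)
  moreover have "(\<Sum>b\<in>Basis. \<Sum>i\<le>n. (f i \<bullet> b) * (g (n - i) \<bullet> b))
      = (\<Sum>i\<le>n. f i \<bullet> g (n - i))" for n
    by (subst sum.swap) (simp add: euclidean_inner[symmetric])
  ultimately show ?thesis
    by (simp only: euclidean_inner[symmetric])
qed

lemma matrix_power_0: "matrix_power A 0 = mat 1"
  by (simp add: matrix_power_def)

lemma matrix_power_Suc: "matrix_power A (Suc k) = A ** matrix_power A k"
  by (simp add: matrix_power_def)

text \<open>\<open>K\<close> is a bound of left multiplication by \<open>A\<close> as a linear map
  on matrices, and \<open>C\<close> is the norm of the identity. This geometric growth lets the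
  exponential series of \<open>K\<close> dominate that of \<open>A\<close>.\<close>

lemma norm_matrix_power_le:
  fixes A :: "real ^ 'n ^ 'n"
  obtains K C where "\<And>k. norm (matrix_power A k) \<le> C * K ^ k"
proof -
  have "linear (\<lambda>M :: real ^ 'n ^ 'n. A ** M)"
    by (rule linearI)
      (simp_all add: matrix_matrix_mult_def vec_eq_iff sum.distrib sum_distrib_left algebra_simps)
  then have "bounded_linear (\<lambda>M :: real ^ 'n ^ 'n. A ** M)"
    by (simp add: linear_conv_bounded_linear)
  then obtain K where K: "K > 0" "\<And>M :: real ^ 'n ^ 'n. norm (A ** M) \<le> norm M * K"
    by (metis bounded_linear.pos_bounded)
  have "norm (matrix_power A k) \<le> norm (mat 1 :: real ^ 'n ^ 'n) * K ^ k" for k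
  proof (induction k)
    case (Suc k)
    have "norm (matrix_power A (Suc k)) \<le> norm (matrix_power A k) * K"
      by (simp add: matrix_power_Suc K(2))
    also have "\<dots> \<le> norm (mat 1 :: real ^ 'n ^ 'n) * K ^ k * K"
      using Suc K(1) by (intro mult_right_mono) auto
    finally show ?case by (simp add: mult_ac)
  qed (simp add: matrix_power_0)
  then show ?thesis using that by blast
qed

lemma summable_norm_matrix_exp:
  fixes A :: "real ^ 'n ^ 'n"
  shows "summable (\<lambda>k. norm ((1 / fact k) *\<^sub>R matrix_power A k))"
proof -
  obtain K C where KC: "\<And>k. norm (matrix_power A k) \<le> C * K ^ k"
    using norm_matrix_power_le by blast
  have "summable (\<lambda>k. C * (inverse (fact k) * K ^ k))"
    by (intro summable_mult summable_exp)
  then show ?thesis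
    by (rule summable_comparison_test')
      (use KC in \<open>simp add: field_simps\<close>)
qed

text \<open>Continuity in the matrix argument allows the series \<open>matrix_exp A\<close> to be
  applied to a vector term by term.\<close>

lemma bounded_linear_matrix_vector_mult_left:
  "bounded_linear (\<lambda>M :: real ^ 'n ^ 'm. M *v x)"
proof -
  have "linear (\<lambda>M :: real ^ 'n ^ 'm. M *v x)"
    by (rule linearI) (simp_all add: matrix_vector_mult_add_rdistrib scaleR_matrix_vector_assoc)
  then show ?thesis
    by (simp add: linear_conv_bounded_linear)
qed

text \<open>Each of the \<open>i\<close> factors \<open>A\<close> carried across the inner product
  costs one sign.\<close>

lemma skew_matrix_power_inner:
  fixes A :: "real ^ 'n ^ 'n"
  assumes "transpose A = - A"
  shows "(matrix_power A i *v x) \<bullet> y = (- 1) ^ i * (x \<bullet> (matrix_power A i *v y))"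
proof (induction i arbitrary: x y)
  case (Suc i)
  have skew: "(A *v u) \<bullet> w = - (u \<bullet> (A *v w))" for u w
  proof -
    have "(A *v u) \<bullet> w = u \<bullet> (transpose A *v w)"
      by (metis dot_lmul_matrix inner_commute transpose_matrix_vector)
    also have "transpose A *v w = - (A *v w)"
      by (simp add: assms matrix_vector_mult_def vec_eq_iff sum_negf)
    finally show ?thesis by simp
  qed
  \<comment> \<open>Carrying the outer \<open>A\<close> across puts it to the right of the
    \<open>i\<close>-th power, while \<open>matrix_power_Suc\<close> has it on the left.\<close>
  have comm: "A ** matrix_power A i = matrix_power A i ** A"
    by (induction i) (simp_all add: matrix_power_0 matrix_power_Suc matrix_mul_assoc)
  show ?case
    by (simp add: matrix_power_Suc skew Suc flip: matrix_vector_mul_assoc)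
      (simp add: comm matrix_vector_mul_assoc)
qed (simp add: matrix_power_0)

lemma matrix_power_add: "matrix_power A (i + j) = matrix_power A i ** matrix_power A j"
  by (induction i) (simp_all add: matrix_power_0 matrix_power_Suc matrix_mul_assoc)

text \<open>Expanding \<open>|e\<^sup>A x|\<^sup>2\<close> as a Cauchy product, skewness turns the \<open>n\<close>-th term into
  a multiple of \<open>(1 - 1)\<^sup>n\<close>.\<close>

theorem norm_matrix_exp_skew:
  fixes A :: "real ^ 'n ^ 'n"
  assumes skew: "transpose A = - A"
  shows "norm (matrix_exp A *v x) = norm x"
proof -
  define f where "f k = ((1 / fact k) *\<^sub>R matrix_power A k) *v x" for k
  interpret L: bounded_linear "\<lambda>M :: real ^ 'n ^ 'n. M *v x"
    by (rule bounded_linear_matrix_vector_mult_left)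
  have summable: "summable (\<lambda>k. norm (f k))"
  proof -
    obtain K where "\<And>M :: real ^ 'n ^ 'n. norm (M *v x) \<le> norm M * K"
      using L.bounded by blast
    then show ?thesis
      unfolding f_def
      by (intro summable_comparison_test'[OF summable_mult2[OF summable_norm_matrix_exp]])
        (simp only: real_norm_def abs_norm_cancel)
  qed
  have exp_eq: "matrix_exp A *v x = suminf f"
    unfolding matrix_exp_def f_def
    by (rule L.suminf) (rule summable_norm_cancel[OF summable_norm_matrix_exp])
  have "(\<Sum>i\<le>n. f i \<bullet> f (n - i)) = (if n = 0 then x \<bullet> x else 0)" for n
  proof -
    \<comment> \<open>Moving the first power across merges both into the \<open>n\<close>-th,
      independent of \<open>i\<close>; the factorials combine to
      \<open>(n choose i) / fact n\<close>.\<close>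
    have "f i \<bullet> f (n - i)
        = (x \<bullet> (matrix_power A n *v x)) / fact n * ((- 1) ^ i * real (n choose i))"
      if "i \<le> n" for i
    proof -
      have "(matrix_power A i *v x) \<bullet> (matrix_power A (n - i) *v x)
          = (- 1) ^ i * (x \<bullet> (matrix_power A n *v x))"
        using that
        by (simp add: skew_matrix_power_inner[OF skew] matrix_vector_mul_assoc
            flip: matrix_power_add)
      then show ?thesis
        using that by (simp add: f_def L.scaleR binomial_fact field_simps)
    qed
    then have "(\<Sum>i\<le>n. f i \<bullet> f (n - i))
        = (x \<bullet> (matrix_power A n *v x)) / fact n * (\<Sum>i\<le>n. (- 1) ^ i * real (n choose i))"
      by (simp add: sum_distrib_left)
    \<comment> \<open>The alternating binomial sum vanishes only for \<open>n > 0\<close>; the term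
      \<open>n = 0\<close> is \<open>x \<bullet> x\<close>.\<close>
    then show ?thesis
      by (cases "n = 0") (simp_all add: choose_alternating_sum matrix_power_0)
  qed
  then have "(\<lambda>n. if n = 0 then x \<bullet> x else 0) sums (suminf f \<bullet> suminf f)"
    using Cauchy_product_inner_sums[OF summable summable] by simp
  then have "suminf f \<bullet> suminf f = x \<bullet> x"
    using sums_If_finite_set[of "{0}" "\<lambda>_. x \<bullet> x"] sums_unique2 by fastforce
  then show ?thesis
    by (simp add: exp_eq norm_eq_sqrt_inner)
qed

text \<open>The free scalar \<open>c\<close> covers both the full step \<open>h\<close> of S1 and
  the half steps of S2.\<close>

lemma norm_matrix_exp_B_tilde: "norm (matrix_exp (c *\<^sub>R B_tilde B x) *v v) = norm v"
  by (rule norm_matrix_exp_skew)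
    (simp add: B_tilde_def transpose_def vec_eq_iff forall_3)

text \<open>The velocities enter only through norms, so one statement serves S1, where
  \<open>v'\<close> is \<open>w + h *\<^sub>R F\<close>, and S2, where a further rotation
  follows.\<close>

lemma modified_energy_kick:
  assumes "norm v' = norm (w + h *\<^sub>R F)" and "norm w = norm v"
  shows "modified_energy v' (exp (ln r - (h *\<^sub>R w + (h\<^sup>2 / 2) *\<^sub>R F) \<bullet> F)) = modified_energy v r"
proof -
  have "(norm v')\<^sup>2 = (norm v)\<^sup>2 + 2 * ((h *\<^sub>R w + (h\<^sup>2 / 2) *\<^sub>R F) \<bullet> F)"
    unfolding assms(1) assms(2)[symmetric]
    by (simp only: power2_norm_eq_inner)
      (simp add: inner_add inner_commute power2_eq_square algebra_simps)
  then show ?thesis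
    unfolding modified_energy_def ln_exp by linarith
qed

lemma S1_ESAV_step_modified_energy:
  assumes "(x', v', r') = S1_ESAV_step U E B h (x, v, r)"
  shows "modified_energy v' r' = modified_energy v r"
  using assms
  \<comment> \<open>\<open>add.assoc\<close> groups \<open>x'\<close> as \<open>x\<close> plus an
    increment, so \<open>x' - x\<close> reduces to the form in
    \<open>modified_energy_kick\<close>.\<close>
  by (auto simp: S1_ESAV_step_def Let_def add.assoc norm_matrix_exp_B_tilde
      intro!: modified_energy_kick)

lemma S2_ESAV_step_modified_energy:
  assumes "(x', v', r') = S2_ESAV_step U E B h (x, v, r)"
  shows "modified_energy v' r' = modified_energy v r"
  using assms
  by (auto simp: S2_ESAV_step_def Let_def add.assoc norm_matrix_exp_B_tilde
      intro!: modified_energy_kick)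

theorem theorem2p2:
  fixes U :: "real ^ 3 \<Rightarrow> real"
    and E B :: "real ^ 3 \<Rightarrow> real ^ 3"
    and x0 v0 :: "real ^ 3"
    and T h :: real
    and N :: nat
    and x v :: "nat \<Rightarrow> real ^ 3"
    and r :: "nat \<Rightarrow> real"
  assumes "\<And>y. GDERIV U y :> - E y"
    and "T > 0" and "h > 0" and "N > 0" and "T / h = real N"
    and "x 0 = x0" and "v 0 = v0" and "r 0 = exp (U x0)"
    and "numerical_solution (S1_ESAV_step U E B h) x v r N \<or>
         numerical_solution (S2_ESAV_step U E B h) x v r N"
  shows "\<forall>n\<in>{1..N}. modified_energy (v n) (r n) = modified_energy (v 0) (r 0) \<and>
                     modified_energy (v 0) (r 0) = energy U x0 v0"
proof -
  have step: "modified_energy (v (Suc n)) (r (Suc n)) = modified_energy (v n) (r n)"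
    if "n < N" for n
    using assms(9) that unfolding numerical_solution_def
    by (metis S1_ESAV_step_modified_energy S2_ESAV_step_modified_energy)
  have "modified_energy (v n) (r n) = modified_energy (v 0) (r 0)" if "n \<le> N" for n
    using that by (induction n) (simp_all add: step)
  \<comment> \<open>The initial value \<open>r 0 = exp (U x0)\<close> makes \<open>ln (r 0)\<close>
    the potential energy.\<close>
  moreover have "modified_energy (v 0) (r 0) = energy U x0 v0"
    using assms(7,8) by (simp add: modified_energy_def energy_def)
  ultimately show ?thesis by simp
qed

end
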